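(* There is no (deterministic online) algorithm with asymptotic competitive ratio smaller than $\frac54$ for the online strip packing problem of squares with Tetris and gravity constraint.
   Context: Problem (online square strip packing with Tetris and gravity constraints): Let $S$ be a semi-infinite vertical strip of width $1$. A sequence of axis-parallel squares with side lengths in $[0,1]$ arrives online, one at a time, unknown in advance; each square must be placed irrevocably before the next is revealed, starting from a position above all previously placed squares. Squares may not overlap and must have sides parallel to the strip. Tetris constraint: when a square is placed, there must be a collision-free path through unoccupied space from its initial position at the top of the strip to its final position. Gravity constraint: no square ever moves upward on its path, and in its final position its bottom side lies on the bottom of the strip or shares a segment of positive length with the top side of a previously placed square. The height of a packing is the distance from the bottom of $S$ to the highest occupied point; $OPT$ is the minimum possible height of a valid packing of the given squares. An online algorithm has asymptotic competitive ratio $c$ if there is a constant $b$ such that on every input its height is at most $c\cdot OPT+b$. *)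

theory Defs
  imports "HOL-Analysis.Analysis"
begin

text \<open>A square is given by its side length and the position of its lower left corner; a placed
  square is a pair of the two. All squares and the strip are closed sets.\<close>

type_synonym pos = "real \<times> real"

definition strip :: "pos set" where
  "strip = {0..1} \<times> {0..}"

definition sq :: "real \<Rightarrow> pos \<Rightarrow> pos set" where
  "sq a p = cbox p (p + (a, a))"

definition bottom_side :: "real \<Rightarrow> pos \<Rightarrow> pos set" where
  "bottom_side a p = closed_segment p (p + (a, 0))"

definition top_side :: "real \<Rightarrow> pos \<Rightarrow> pos set" where
  "top_side a p = closed_segment (p + (0, a)) (p + (a, a))"

text \<open>Squares may touch. For positive side lengths this is disjointness of the interiors; the
  asymmetric form also forbids a degenerate square (side length 0) inside another square.\<close>

definition overlap :: "pos set \<Rightarrow> pos set \<Rightarrow> bool" where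
  "overlap A B \<longleftrightarrow> interior A \<inter> B \<noteq> {} \<or> A \<inter> interior B \<noteq> {}"

text \<open>The curve \<open>\<gamma>\<close> traces the lower left corner of the moving square. It serves both
  constraints: it avoids the squares in \<open>Q\<close> (Tetris) and never goes up (gravity).\<close>

definition admissible_path :: "(real \<times> pos) set \<Rightarrow> real \<Rightarrow> (real \<Rightarrow> pos) \<Rightarrow> bool" where
  "admissible_path Q a \<gamma> \<longleftrightarrow>
     path \<gamma> \<and>
     (\<forall>(b, q) \<in> Q. snd (pathstart \<gamma>) \<ge> snd q + b) \<and>
     (\<forall>t \<in> {0..1}. sq a (\<gamma> t) \<subseteq> strip \<and> (\<forall>(b, q) \<in> Q. \<not> overlap (sq a (\<gamma> t)) (sq b q))) \<and>
     antimono_on {0..1} (\<lambda>t. snd (\<gamma> t))"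

definition supported :: "(real \<times> pos) set \<Rightarrow> real \<Rightarrow> pos \<Rightarrow> bool" where
  "supported Q a p \<longleftrightarrow>
     snd p = 0 \<or>
     (\<exists>(b, q) \<in> Q. \<exists>u v. u \<noteq> v \<and> closed_segment u v \<subseteq> bottom_side a p \<inter> top_side b q)"

definition valid_placement :: "(real \<times> pos) set \<Rightarrow> real \<Rightarrow> pos \<Rightarrow> bool" where
  "valid_placement Q a p \<longleftrightarrow>
     (\<exists>\<gamma>. admissible_path Q a \<gamma> \<and> pathfinish \<gamma> = p) \<and> supported Q a p"

text \<open>The squares are placed in the order of the list; square \<open>i\<close> has side length \<open>as ! i\<close> and
  final position \<open>ps ! i\<close>.\<close>

definition valid_packing :: "real list \<Rightarrow> pos list \<Rightarrow> bool" where
  "valid_packing as ps \<longleftrightarrow>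
     length ps = length as \<and>
     (\<forall>i < length as. valid_placement (set (take i (zip as ps))) (as ! i) (ps ! i))"

definition height :: "real list \<Rightarrow> pos list \<Rightarrow> real" where
  "height as ps = Max (insert 0 ((\<lambda>(a, p). snd p + a) ` set (zip as ps)))"

text \<open>The optimum is over packings of the same squares in the same order, with all squares known
  in advance. An infimum is used because contact in a segment of positive length is not a closed
  condition; where the minimum exists, the two agree.\<close>

definition OPT :: "real list \<Rightarrow> real" where
  "OPT as = (INF ps \<in> {ps. valid_packing as ps}. height as ps)"

definition inputs :: "real list set" where
  "inputs = {as. set as \<subseteq> {0..1}}"

text \<open>A deterministic online strategy maps the side lengths revealed so far to the position of the
  last of them. Earlier positions are determined by shorter prefixes, so they need not be
  arguments.\<close>

definition run :: "(real list \<Rightarrow> pos) \<Rightarrow> real list \<Rightarrow> pos list" where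
  "run alg as = map (\<lambda>i. alg (take (Suc i) as)) [0..<length as]"

definition online_algorithm :: "(real list \<Rightarrow> pos) \<Rightarrow> bool" where
  "online_algorithm alg \<longleftrightarrow> (\<forall>as \<in> inputs. valid_packing as (run alg as))"

definition has_asymptotic_competitive_ratio :: "(real list \<Rightarrow> pos) \<Rightarrow> real \<Rightarrow> bool" where
  "has_asymptotic_competitive_ratio alg c \<longleftrightarrow>
     (\<exists>b. \<forall>as \<in> inputs. height as (run alg as) \<le> c * OPT as + b)"

end

theory Submission
  imports Defs
begin

text \<open>The adversary works in rounds. A round starts with two squares of side \<open>s\<close> slightly larger
  than \<open>1/4\<close>, where \<open>s\<close> grows strictly from round to round. If the algorithm puts one of them at least
  \<open>s\<close> above its current level, a square of side \<open>3/4 > 1 - s\<close> follows: it lands above both, so the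
  algorithm gains at least \<open>5/4\<close>, while \<open>s + 3/4\<close> suffices if the two small squares lie side by
  side. Otherwise the small squares are disjoint in their horizontal extent, and a square of side
  \<open>1 - s\<close> follows: it cannot pass both, so the algorithm gains at least \<open>1\<close>, while \<open>1 - s\<close> suffices
  if the two small squares are piled up in a corner. In both cases the large square seals the
  strip against all squares of side larger than \<open>s\<close>, hence against all later rounds.\<close>

section \<open>Squares, overlap and the strip in coordinates\<close>

lemma mem_sq:
  "z \<in> sq a p \<longleftrightarrow>
     fst p \<le> fst z \<and> fst z \<le> fst p + a \<and> snd p \<le> snd z \<and> snd z \<le> snd p + a"
  by (cases p; cases z) (auto simp: sq_def cbox_Pair_eq)

lemma mem_interior_sq:
  "z \<in> interior (sq a p) \<longleftrightarrow>
     fst p < fst z \<and> fst z < fst p + a \<and> snd p < snd z \<and> snd z < snd p + a"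
proof -
  have "sq a p = {fst p..fst p + a} \<times> {snd p..snd p + a}"
    by (cases p) (simp add: sq_def cbox_Pair_eq)
  then show ?thesis
    by (cases z) (auto simp: interior_Times)
qed

lemma overlap_sq_iff:
  assumes "a > 0" "b > 0"
  shows "overlap (sq a p) (sq b q) \<longleftrightarrow>
    fst p < fst q + b \<and> fst q < fst p + a \<and> snd p < snd q + b \<and> snd q < snd p + a"
    (is "_ \<longleftrightarrow> ?R")
proof
  assume "overlap (sq a p) (sq b q)"
  then show ?R
    unfolding overlap_def by (force simp: mem_sq mem_interior_sq)
next
  assume R: ?R
  obtain x where x: "max (fst p) (fst q) < x" "x < min (fst p + a) (fst q + b)"
    using dense[of "max (fst p) (fst q)" "min (fst p + a) (fst q + b)"] R assms by auto
  obtain y where y: "max (snd p) (snd q) < y" "y < min (snd p + a) (snd q + b)"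
    using dense[of "max (snd p) (snd q)" "min (snd p + a) (snd q + b)"] R assms by auto
  have "(x, y) \<in> interior (sq a p) \<inter> sq b q"
    using x y by (simp add: mem_sq mem_interior_sq)
  then show "overlap (sq a p) (sq b q)"
    unfolding overlap_def by blast
qed

lemma sq_subset_strip_iff:
  assumes "a \<ge> 0"
  shows "sq a p \<subseteq> strip \<longleftrightarrow> 0 \<le> fst p \<and> fst p + a \<le> 1 \<and> 0 \<le> snd p"
proof
  assume sub: "sq a p \<subseteq> strip"
  have "p \<in> sq a p" "p + (a, a) \<in> sq a p"
    using assms by (auto simp: mem_sq)
  with sub have "p \<in> strip" "p + (a, a) \<in> strip"
    by blast+
  then show "0 \<le> fst p \<and> fst p + a \<le> 1 \<and> 0 \<le> snd p"
    by (auto simp: strip_def mem_Times_iff)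
qed (auto simp: strip_def mem_sq)

section \<open>Levels that cannot be passed\<close>

text \<open>Intermediate value theorem: a height that starts at \<open>m\<close> or more and ends
  below \<open>m\<close> takes all values just below \<open>m\<close>, hence one in the forbidden
  gap.\<close>

lemma snd_pathfinish_ge:
  fixes \<gamma> :: "real \<Rightarrow> pos"
  assumes "path \<gamma>" "l < m" "m \<le> snd (pathstart \<gamma>)"
    and gap: "\<And>t. t \<in> {0..1} \<Longrightarrow> \<not> (l < snd (\<gamma> t) \<and> snd (\<gamma> t) < m)"
  shows "m \<le> snd (pathfinish \<gamma>)"
proof (rule ccontr)
  assume "\<not> m \<le> snd (pathfinish \<gamma>)"
  then have less: "snd (\<gamma> 1) < m"
    by (simp add: pathfinish_def)
  obtain v where v: "max l (snd (\<gamma> 1)) < v" "v < m"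
    using dense[of "max l (snd (\<gamma> 1))" m] less assms by auto
  have cont: "continuous_on {0..1} (\<lambda>t. snd (\<gamma> t))"
    using \<open>path \<gamma>\<close> unfolding path_def by (intro continuous_intros)
  have "\<exists>t\<ge>0. t \<le> 1 \<and> snd (\<gamma> t) = v"
    using v assms by (intro IVT2'[OF _ _ _ cont]) (auto simp: pathstart_def)
  then obtain t where "t \<in> {0..1}" "snd (\<gamma> t) = v"
    by auto
  then show False
    using gap v by auto
qed

lemma admissible_path_in_strip:
  assumes "admissible_path Q a \<gamma>" "a \<ge> 0" "t \<in> {0..1}"
  shows "0 \<le> fst (\<gamma> t)" "fst (\<gamma> t) + a \<le> 1" "0 \<le> snd (\<gamma> t)"
  using assms sq_subset_strip_iff[of a "\<gamma> t"] unfolding admissible_path_def by auto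

lemma admissible_path_no_overlap:
  assumes "admissible_path Q a \<gamma>" "a > 0" "t \<in> {0..1}" "(b, q) \<in> Q" "b > 0"
  shows "\<not> (fst (\<gamma> t) < fst q + b \<and> fst q < fst (\<gamma> t) + a \<and>
            snd (\<gamma> t) < snd q + b \<and> snd q < snd (\<gamma> t) + a)"
proof -
  have "\<not> overlap (sq a (\<gamma> t)) (sq b q)"
    using assms unfolding admissible_path_def by blast
  then show ?thesis
    using assms by (simp add: overlap_sq_iff)
qed

lemma admissible_path_start:
  assumes "admissible_path Q a \<gamma>" "(b, q) \<in> Q"
  shows "snd q + b \<le> snd (pathstart \<gamma>)"
  using assms unfolding admissible_path_def by blast

text \<open>Bounds all admissible paths, with or without support at the end: further squares may
  create support but can only remove paths, so the bound survives all later placements.\<close>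

definition floor_at :: "(real \<times> pos) set \<Rightarrow> real \<Rightarrow> real \<Rightarrow> bool" where
  "floor_at Q s h \<longleftrightarrow>
     (\<forall>a \<gamma>. s < a \<longrightarrow> admissible_path Q a \<gamma> \<longrightarrow> h \<le> snd (pathfinish \<gamma>))"

lemma floor_atD: "floor_at Q s h \<Longrightarrow> s < a \<Longrightarrow> valid_placement Q a p \<Longrightarrow> h \<le> snd p"
  unfolding floor_at_def valid_placement_def by blast

lemma floor_at_mono: "floor_at Q s h \<Longrightarrow> Q \<subseteq> Q' \<Longrightarrow> floor_at Q' s h"
  unfolding floor_at_def admissible_path_def by blast

lemma floor_at_weaken: "floor_at Q s h \<Longrightarrow> h' \<le> h \<Longrightarrow> floor_at Q s h'"
  unfolding floor_at_def by (meson order_trans)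

lemma floor_at_0: "s \<ge> 0 \<Longrightarrow> floor_at Q s 0"
  unfolding floor_at_def pathfinish_def by (auto intro: admissible_path_in_strip)

text \<open>Since \<open>1 - b \<le> s < a\<close>, a square of side \<open>a\<close> does not fit
  beside the one at \<open>q\<close>. The heights at which the two overlap vertically form a gap
  that no path crosses.\<close>

lemma floor_at_square:
  assumes "(b, q) \<in> Q" "b > 0" "0 \<le> fst q" "fst q + b \<le> 1" "1 \<le> s + b"
  shows "floor_at Q s (snd q + b)"
  unfolding floor_at_def
proof (intro allI impI)
  fix a \<gamma>
  assume a: "s < a" and adm: "admissible_path Q a \<gamma>"
  have "a > 0"
    using a assms by linarith
  show "snd q + b \<le> snd (pathfinish \<gamma>)"
  proof (rule snd_pathfinish_ge)
    show "path \<gamma>"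
      using adm by (simp add: admissible_path_def)
    show "snd q - a < snd q + b"
      using \<open>a > 0\<close> \<open>b > 0\<close> by linarith
    show "snd q + b \<le> snd (pathstart \<gamma>)"
      using adm assms(1) by (rule admissible_path_start)
    fix t :: real
    assume t: "t \<in> {0..1}"
    show "\<not> (snd q - a < snd (\<gamma> t) \<and> snd (\<gamma> t) < snd q + b)"
      using admissible_path_no_overlap[OF adm \<open>a > 0\<close> t assms(1,2)]
        admissible_path_in_strip[OF adm _ t] a \<open>a > 0\<close> assms by auto
  qed
qed

text \<open>A square of side \<open>1 - s\<close> has horizontal leeway \<open>s\<close>. Passing
  the left small square forces it against the right wall, passing the right one forces it against
  the left wall, and \<open>0 < s\<close> excludes both at once.\<close>

lemma two_squares_block:
  assumes adm: "admissible_path Q (1 - s) \<gamma>" and s: "0 < s" "s < 1"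
    and Q: "(s, p) \<in> Q" "(s, q) \<in> Q"
    and p: "0 \<le> fst p" "fst p + s \<le> 1" and q: "0 \<le> fst q" "fst q + s \<le> 1"
    and disj: "fst p + s \<le> fst q \<or> fst q + s \<le> fst p"
    and close: "\<bar>snd p - snd q\<bar> < s"
  shows "min (snd p) (snd q) + s \<le> snd (pathfinish \<gamma>)"
proof (rule snd_pathfinish_ge)
  show "path \<gamma>"
    using adm by (simp add: admissible_path_def)
  \<comment> \<open>The gap consists of the heights at which the moving square overlaps both small
    squares vertically; it is nonempty because their levels differ by less than
    \<open>s < 1\<close>.\<close>
  show "max (snd p) (snd q) - (1 - s) < min (snd p) (snd q) + s"
    using close s by linarith
  show "min (snd p) (snd q) + s \<le> snd (pathstart \<gamma>)"
    using admissible_path_start[OF adm Q(1)] by linarith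
  fix t :: real
  assume t: "t \<in> {0..1}"
  have pos: "1 - s > 0"
    using s by simp
  show "\<not> (max (snd p) (snd q) - (1 - s) < snd (\<gamma> t) \<and> snd (\<gamma> t) < min (snd p) (snd q) + s)"
    using admissible_path_no_overlap[OF adm pos t Q(1) s(1)]
      admissible_path_no_overlap[OF adm pos t Q(2) s(1)]
      admissible_path_in_strip(1,2)[OF adm less_imp_le[OF pos] t] p q disj s by argo
qed

lemma valid_placement_in_strip:
  assumes "valid_placement Q a p" "a \<ge> 0"
  shows "0 \<le> fst p" "fst p + a \<le> 1" "0 \<le> snd p"
  using assms admissible_path_in_strip[of Q a _ 1]
  unfolding valid_placement_def pathfinish_def by fastforce+

lemma valid_placement_no_overlap:
  assumes "valid_placement Q a p" "a > 0" "(b, q) \<in> Q" "b > 0"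
  shows "\<not> (fst p < fst q + b \<and> fst q < fst p + a \<and> snd p < snd q + b \<and> snd q < snd p + a)"
  using assms admissible_path_no_overlap[of Q a _ 1 b q]
  unfolding valid_placement_def pathfinish_def by fastforce

section \<open>Dropping a square vertically\<close>

lemma mem_horizontal_segment:
  fixes x a u y :: real
  assumes "a > 0" "x \<le> u" "u \<le> x + a"
  shows "(u, y) \<in> closed_segment (x, y) ((x, y) + (a, 0))"
  unfolding in_segment
  by (rule exI[of _ "(u - x) / a"]) (use assms in \<open>auto simp: field_simps\<close>)

lemma supported_by_square:
  assumes "(b, q) \<in> Q" "b > 0" "a > 0" "snd q + b = y" "x < fst q + b" "fst q < x + a"
  shows "supported Q a (x, y)"
proof -
  \<comment> \<open>The ends of the horizontal range common to both sides; by convexity the segment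
    between them lies in both.\<close>
  define u where "u = max x (fst q)"
  define v where "v = min (x + a) (fst q + b)"
  have "u < v"
    using assms by (auto simp: u_def v_def)
  have "(u, y) \<in> bottom_side a (x, y)" "(v, y) \<in> bottom_side a (x, y)"
    unfolding bottom_side_def using assms
    by (auto intro!: mem_horizontal_segment simp: u_def v_def simp del: add_Pair)
  moreover have top: "top_side b q = closed_segment (fst q, y) ((fst q, y) + (b, 0))"
    using assms(4) by (cases q) (simp add: top_side_def)
  have "(u, y) \<in> top_side b q" "(v, y) \<in> top_side b q"
    unfolding top using assms
    by (auto intro!: mem_horizontal_segment simp: u_def v_def simp del: add_Pair)
  ultimately have "closed_segment (u, y) (v, y) \<subseteq> bottom_side a (x, y) \<inter> top_side b q"
    by (simp add: bottom_side_def top_side_def closed_segment_subset)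
  moreover have "(u, y) \<noteq> (v, y)"
    using \<open>u < v\<close> by simp
  ultimately show ?thesis
    unfolding supported_def using assms(1) by blast
qed

text \<open>By \<open>free\<close>, no square in the column over the target reaches above
  \<open>y\<close>, so a straight vertical descent meets no obstacle.\<close>

lemma valid_placement_drop:
  assumes "finite Q" "a > 0" and strip: "0 \<le> x" "x + a \<le> 1" "0 \<le> y"
    and pos: "\<And>b q. (b, q) \<in> Q \<Longrightarrow> b > 0"
    and free: "\<And>b q. (b, q) \<in> Q \<Longrightarrow> snd q + b \<le> y \<or> x + a \<le> fst q \<or> fst q + b \<le> x"
    and "supported Q a (x, y)"
  shows "valid_placement Q a (x, y)"
proof -
  \<comment> \<open>Starting height, at or above every top; including \<open>y\<close> makes the
    path descend and covers the case of empty \<open>Q\<close>.\<close>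
  define Y where "Y = Max (insert y ((\<lambda>(b, q). snd q + b) ` Q))"
  have Y: "y \<le> Y" "\<And>b q. (b, q) \<in> Q \<Longrightarrow> snd q + b \<le> Y"
    unfolding Y_def using \<open>finite Q\<close> by (auto intro!: Max_ge image_eqI)
  define \<gamma> where "\<gamma> = linepath (x, Y) (x, y)"
  have \<gamma>: "fst (\<gamma> t) = x" "snd (\<gamma> t) = Y - t * (Y - y)" for t
    by (simp_all add: \<gamma>_def linepath_def algebra_simps)
  have ge: "y \<le> snd (\<gamma> t)" if "t \<in> {0..1}" for t
  proof -
    have "t * (Y - y) \<le> 1 * (Y - y)"
      using that Y(1) by (intro mult_right_mono) auto
    then show ?thesis
      by (simp add: \<gamma>(2))
  qed
  have "admissible_path Q a \<gamma>"
    unfolding admissible_path_def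
  proof (intro conjI ballI)
    show "path \<gamma>"
      by (simp add: \<gamma>_def)
    show "case z of (b, q) \<Rightarrow> snd q + b \<le> snd (pathstart \<gamma>)" if "z \<in> Q" for z
      using that Y(2) by (auto simp: \<gamma>_def)
    show "sq a (\<gamma> t) \<subseteq> strip" if "t \<in> {0..1}" for t
      using ge[OF that] strip \<open>a > 0\<close> by (simp add: sq_subset_strip_iff \<gamma>(1))
    show "case z of (b, q) \<Rightarrow> \<not> overlap (sq a (\<gamma> t)) (sq b q)" if "t \<in> {0..1}" "z \<in> Q" for t z
    proof -
      obtain b q where "z = (b, q)"
        by (cases z)
      then show ?thesis
        using free[of b q] pos[of b q] ge[OF that(1)] that(2) \<open>a > 0\<close>
        by (auto simp: overlap_sq_iff \<gamma>(1))
    qed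
    show "antimono_on {0..1} (\<lambda>t. snd (\<gamma> t))"
      using Y(1) by (auto simp: monotone_on_def \<gamma>(2) intro!: mult_right_mono)
  qed
  moreover have "pathfinish \<gamma> = (x, y)"
    by (simp add: \<gamma>_def)
  ultimately show ?thesis
    unfolding valid_placement_def using assms by blast
qed

section \<open>Packings as lists\<close>

lemma valid_packing_Nil: "valid_packing [] []"
  by (simp add: valid_packing_def)

lemma valid_packing_snoc:
  assumes "length ps = length as"
  shows "valid_packing (as @ [a]) (ps @ [p]) \<longleftrightarrow>
    valid_packing as ps \<and> valid_placement (set (zip as ps)) a p"
  using assms unfolding valid_packing_def
  by (auto simp: nth_append less_Suc_eq)

lemma valid_packing_length: "valid_packing as ps \<Longrightarrow> length ps = length as"
  by (simp add: valid_packing_def)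

lemma length_run: "length (run alg as) = length as"
  by (simp add: run_def)

lemma run_snoc: "run alg (as @ [a]) = run alg as @ [alg (as @ [a])]"
  by (simp add: run_def)

lemma zip_run_snoc:
  "set (zip (as @ [a]) (run alg (as @ [a]))) =
     insert (a, alg (as @ [a])) (set (zip as (run alg as)))"
  by (simp add: run_snoc length_run)

lemma online_algorithm_placement:
  assumes "online_algorithm alg" "as @ [a] \<in> inputs"
  shows "valid_placement (set (zip as (run alg as))) a (alg (as @ [a]))"
proof -
  have "valid_packing (as @ [a]) (run alg (as @ [a]))"
    using assms unfolding online_algorithm_def by blast
  then show ?thesis
    by (simp add: run_snoc valid_packing_snoc length_run)
qed

lemma height_ge: "(a, p) \<in> set (zip as ps) \<Longrightarrow> snd p + a \<le> height as ps"
  unfolding height_def by (rule Max_ge) (auto intro!: image_eqI)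

lemma height_nonneg: "0 \<le> height as ps"
  unfolding height_def by (rule Max_ge) auto

lemma height_le:
  assumes "0 \<le> h" "\<And>a p. (a, p) \<in> set (zip as ps) \<Longrightarrow> snd p + a \<le> h"
  shows "height as ps \<le> h"
  unfolding height_def using assms by (subst Max_le_iff) auto

lemma OPT_le_height: "valid_packing as ps \<Longrightarrow> OPT as \<le> height as ps"
  unfolding OPT_def by (rule cINF_lower) (auto intro!: bdd_belowI2[of _ 0] height_nonneg)

text \<open>The packing \<open>ps\<close> shows that the set of heights is nonempty; the infimum of
  an empty set of reals would be unspecified.\<close>

lemma OPT_nonneg: "valid_packing as ps \<Longrightarrow> 0 \<le> OPT as"
  unfolding OPT_def by (rule cINF_greatest) (auto intro: height_nonneg)

section \<open>One round of the adversary\<close>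

text \<open>Invariant of the offline packing: level \<open>h\<close> acts as a flat base over the
  range from \<open>s\<close> to \<open>3 / 4\<close>, which both possible large squares cover.
  Phrased through \<open>supported\<close>, it also holds for the bottom of the empty strip.\<close>

definition ground :: "(real \<times> pos) set \<Rightarrow> real \<Rightarrow> real \<Rightarrow> bool" where
  "ground Q s h \<longleftrightarrow>
     (\<forall>(b, q) \<in> Q. 0 < b \<and> snd q + b \<le> h) \<and>
     (\<forall>x a. x < 3 / 4 \<longrightarrow> 0 < a \<longrightarrow> s < x + a \<longrightarrow> supported Q a (x, h))"

lemma groundD:
  assumes "ground Q s h"
  shows "(b, q) \<in> Q \<Longrightarrow> 0 < b" "(b, q) \<in> Q \<Longrightarrow> snd q + b \<le> h"
    "x < 3 / 4 \<Longrightarrow> 0 < a \<Longrightarrow> s < x + a \<Longrightarrow> supported Q a (x, h)"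
  using assms unfolding ground_def by blast+

lemma ground_square:
  assumes "(b, q) \<in> Q" "fst q \<le> s" "3 / 4 \<le> fst q + b" "snd q + b = h"
    and "\<And>b q. (b, q) \<in> Q \<Longrightarrow> 0 < b \<and> snd q + b \<le> h"
  shows "ground Q s h"
  unfolding ground_def
proof (intro conjI allI impI)
  fix x a :: real
  assume "x < 3 / 4" "0 < a" "s < x + a"
  then show "supported Q a (x, h)"
    using assms by (intro supported_by_square[of b q]) auto
qed (use assms in auto)

text \<open>Piled in the left corner, the small squares leave exactly width \<open>1 - s\<close> for
  the large one. As \<open>s \<le> 1 / 3\<close>, the pile is no higher than the large square, so
  the level rises by \<open>1 - s\<close> only.\<close>

lemma packing_piled:
  assumes val: "valid_packing as ps" and g: "ground (set (zip as ps)) \<sigma> h" and "0 \<le> h"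
    and s: "0 < s" "\<sigma> < s" "s \<le> 1 / 3"
  defines "ps' \<equiv> ps @ [(0, h), (0, h + s), (s, h)]"
  shows "valid_packing (as @ [s, s, 1 - s]) ps'"
    and "ground (set (zip (as @ [s, s, 1 - s]) ps')) s (h + (1 - s))"
proof -
  let ?Q = "set (zip as ps)"
  have len: "length ps = length as"
    using val by (rule valid_packing_length)
  note g = groundD[OF g]
  \<comment> \<open>The growth of the sides matters here: the old base may begin only at
    \<open>\<sigma>\<close>, and a square in the corner reaches it because
    \<open>\<sigma> < s\<close>.\<close>
  have 1: "valid_placement ?Q s (0, h)"
    using s \<open>0 \<le> h\<close> by (intro valid_placement_drop) (auto intro: g)
  have 2: "valid_placement (insert (s, (0, h)) ?Q) s (0, h + s)"
    using s \<open>0 \<le> h\<close>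
    by (intro valid_placement_drop) (auto intro: g supported_by_square dest: g(2))
  have sup: "supported (insert (s, (0, h + s)) (insert (s, (0, h)) ?Q)) (1 - s) (s, h)"
    using g(3)[of s "1 - s"] s unfolding supported_def by auto
  have 3: "valid_placement (insert (s, (0, h + s)) (insert (s, (0, h)) ?Q)) (1 - s) (s, h)"
    using s \<open>0 \<le> h\<close> sup by (intro valid_placement_drop) (auto intro: g)
  show "valid_packing (as @ [s, s, 1 - s]) ps'"
    using val 1 2 3 len valid_packing_snoc[of "ps @ [(0, h), (0, h + s)]" "as @ [s, s]"]
      valid_packing_snoc[of "ps @ [(0, h)]" "as @ [s]"] valid_packing_snoc[of ps as]
    by (simp add: ps'_def insert_commute)
  have "set (zip (as @ [s, s, 1 - s]) ps') = ?Q \<union> {(s, (0, h)), (s, (0, h + s)), (1 - s, (s, h))}"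
    using len by (simp add: ps'_def)
  then show "ground (set (zip (as @ [s, s, 1 - s]) ps')) s (h + (1 - s))"
    using s by (intro ground_square[of "1 - s" "(s, h)"]) (auto intro: g dest: g(2))
qed

text \<open>The large square rests on the small ones at the left wall; the rise
  \<open>s + 3 / 4\<close> is close to \<open>1\<close> when \<open>s\<close> is close to
  \<open>1 / 4\<close>.\<close>

lemma packing_side_by_side:
  assumes val: "valid_packing as ps" and g: "ground (set (zip as ps)) \<sigma> h" and "0 \<le> h"
    and s: "0 < s" "\<sigma> < s" "s \<le> 1 / 3"
  defines "ps' \<equiv> ps @ [(0, h), (s, h), (0, h + s)]"
  shows "valid_packing (as @ [s, s, 3 / 4]) ps'"
    and "ground (set (zip (as @ [s, s, 3 / 4]) ps')) s (h + s + 3 / 4)"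
proof -
  let ?Q = "set (zip as ps)"
  have len: "length ps = length as"
    using val by (rule valid_packing_length)
  note g = groundD[OF g]
  have 1: "valid_placement ?Q s (0, h)"
    using s \<open>0 \<le> h\<close> by (intro valid_placement_drop) (auto intro: g)
  have sup: "supported (insert (s, (0, h)) ?Q) s (s, h)"
    using g(3)[of s s] s unfolding supported_def by auto
  have 2: "valid_placement (insert (s, (0, h)) ?Q) s (s, h)"
    using s \<open>0 \<le> h\<close> sup by (intro valid_placement_drop) (auto intro: g)
  have "supported (insert (s, (s, h)) (insert (s, (0, h)) ?Q)) (3 / 4) (0, h + s)"
    by (rule supported_by_square[of s "(0, h)"]) (use s in auto)
  then have 3: "valid_placement (insert (s, (s, h)) (insert (s, (0, h)) ?Q)) (3 / 4) (0, h + s)"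
    using s \<open>0 \<le> h\<close> by (intro valid_placement_drop) (auto intro: g(1) dest: g(2))
  show "valid_packing (as @ [s, s, 3 / 4]) ps'"
    using val 1 2 3 len valid_packing_snoc[of "ps @ [(0, h), (s, h)]" "as @ [s, s]"]
      valid_packing_snoc[of "ps @ [(0, h)]" "as @ [s]"] valid_packing_snoc[of ps as]
    by (simp add: ps'_def insert_commute)
  have "set (zip (as @ [s, s, 3 / 4]) ps') = ?Q \<union> {(s, (0, h)), (s, (s, h)), (3 / 4, (0, h + s))}"
    using len by (simp add: ps'_def)
  then show "ground (set (zip (as @ [s, s, 3 / 4]) ps')) s (h + s + 3 / 4)"
    using s by (intro ground_square[of "3 / 4" "(0, h + s)"]) (auto intro: g dest: g(2))
qed

text \<open>\<open>H\<close> is a level below which no square of the round can sink;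
  \<open>G\<close> is the guaranteed rise of this level after the adversary's reply
  \<open>B\<close>.\<close>

lemma algorithm_round:
  assumes alg: "online_algorithm alg" and as: "as \<in> inputs"
    and fl: "floor_at (set (zip as (run alg as))) \<sigma> H"
    and s: "\<sigma> < s" "1 / 4 < s" "s \<le> 1 / 3"
  obtains B G where "B = 3 / 4 \<and> G = 5 / 4 \<or> B = 1 - s \<and> G = 1"
    "floor_at (set (zip (as @ [s, s, B]) (run alg (as @ [s, s, B])))) s (H + G)"
    "H + G \<le> height (as @ [s, s, B]) (run alg (as @ [s, s, B]))"
proof -
  \<comment> \<open>Both positions depend only on the prefix ending with the small squares, so
    \<open>B\<close> may be chosen after looking at them.\<close>
  define p where "p = alg (as @ [s])"
  define q where "q = alg (as @ [s, s])"
  let ?Q = "set (zip as (run alg as))"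
  let ?Q1 = "insert (s, p) ?Q"
  let ?Q2 = "insert (s, q) ?Q1"
  have Q1: "set (zip (as @ [s]) (run alg (as @ [s]))) = ?Q1"
    by (simp add: zip_run_snoc p_def)
  have Q2: "set (zip (as @ [s, s]) (run alg (as @ [s, s]))) = ?Q2"
    using zip_run_snoc[of "as @ [s]" s alg] Q1 by (simp add: q_def)
  have plp: "valid_placement ?Q s p"
    using online_algorithm_placement[OF alg, of as s] as s by (simp add: p_def inputs_def)
  have plq: "valid_placement ?Q1 s q"
    using online_algorithm_placement[OF alg, of "as @ [s]" s] as s Q1
    by (simp add: q_def inputs_def)
  have s0: "0 \<le> s" "0 < s"
    using s by auto
  note strip = valid_placement_in_strip[OF plp s0(1)] valid_placement_in_strip[OF plq s0(1)]
  have Hp: "H \<le> snd p"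
    using floor_atD[OF fl s(1) plp] .
  have Hq: "H \<le> snd q"
    using floor_atD[OF floor_at_mono[OF fl] s(1) plq] by blast
  show thesis
  proof (cases "H + s \<le> max (snd p) (snd q)")
    case True
    define r where "r = alg (as @ [s, s, 3 / 4])"
    have plr: "valid_placement ?Q2 (3 / 4) r"
      using online_algorithm_placement[OF alg, of "as @ [s, s]" "3 / 4"] as s Q2
      by (simp add: r_def inputs_def)
    \<comment> \<open>With threshold \<open>1 - s\<close> each small square is a floor on its own,
      and \<open>3 / 4 > 1 - s\<close>.\<close>
    have "floor_at ?Q2 (1 - s) (snd p + s)" "floor_at ?Q2 (1 - s) (snd q + s)"
      using strip s by (intro floor_at_square; simp)+
    then have "snd p + s \<le> snd r" "snd q + s \<le> snd r"
      using s by (auto intro: floor_atD[OF _ _ plr])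
    \<comment> \<open>One small square has its top at \<open>H + 2 * s\<close> or higher, and
      \<open>s > 1 / 4\<close>.\<close>
    then have top: "H + 5 / 4 \<le> snd r + 3 / 4"
      using True s by linarith
    let ?as = "as @ [s, s, 3 / 4]"
    have r: "(3 / 4, r) \<in> set (zip ?as (run alg ?as))"
      using zip_run_snoc[of "as @ [s, s]" "3 / 4" alg] by (simp add: r_def)
    show thesis
    proof (rule that)
      show "floor_at (set (zip ?as (run alg ?as))) s (H + 5 / 4)"
        using valid_placement_in_strip[OF plr] s
        by (intro floor_at_weaken[OF floor_at_square[OF r] top]) auto
      show "H + 5 / 4 \<le> height ?as (run alg ?as)"
        using height_ge[OF r] top by linarith
    qed simp
  next
    case False
    define r where "r = alg (as @ [s, s, 1 - s])"
    have plr: "valid_placement ?Q2 (1 - s) r"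
      using online_algorithm_placement[OF alg, of "as @ [s, s]" "1 - s"] as s Q2
      by (simp add: r_def inputs_def)
    then obtain \<gamma> where \<gamma>: "admissible_path ?Q2 (1 - s) \<gamma>" "pathfinish \<gamma> = r"
      unfolding valid_placement_def by blast
    \<comment> \<open>Both levels lie between \<open>H\<close> and \<open>H + s\<close>, so the
      small squares overlap vertically and must be disjoint horizontally.\<close>
    have close: "\<bar>snd p - snd q\<bar> < s"
      using False Hp Hq by linarith
    have disj: "fst p + s \<le> fst q \<or> fst q + s \<le> fst p"
      using valid_placement_no_overlap[OF plq s0(2), of s p] close s0 by force
    have "min (snd p) (snd q) + s \<le> snd r"
      using two_squares_block[OF \<gamma>(1) _ _ _ _ _ _ _ _ disj close] strip s \<gamma>(2) by simp
    then have top: "H + 1 \<le> snd r + (1 - s)"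
      using Hp Hq by linarith
    let ?as = "as @ [s, s, 1 - s]"
    have r: "(1 - s, r) \<in> set (zip ?as (run alg ?as))"
      using zip_run_snoc[of "as @ [s, s]" "1 - s" alg] by (simp add: r_def)
    show thesis
    proof (rule that)
      show "floor_at (set (zip ?as (run alg ?as))) s (H + 1)"
        using valid_placement_in_strip[OF plr] s
        by (intro floor_at_weaken[OF floor_at_square[OF r] top]) auto
      show "H + 1 \<le> height ?as (run alg ?as)"
        using height_ge[OF r] top by linarith
    qed simp
  qed
qed

section \<open>Iterating the rounds\<close>

text \<open>An offline packing of level \<open>h\<close> is built in parallel, and every round
  preserves the factor \<open>r\<close> between the two levels. The bound \<open>\<epsilon>\<close>
  keeps \<open>s + 3 / 4\<close> below \<open>1 + \<epsilon>\<close>, and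
  \<open>\<epsilon> \<le> 1 / 12\<close> keeps \<open>s \<le> 1 / 3\<close>.\<close>

lemma adversary:
  assumes alg: "online_algorithm alg" and \<epsilon>: "0 < \<epsilon>" "\<epsilon> \<le> 1 / 12"
    and r: "0 \<le> r" "r * (1 + \<epsilon>) \<le> 5 / 4"
  shows "\<exists>as ps \<sigma> h. as \<in> inputs \<and> valid_packing as ps \<and> 1 / 4 \<le> \<sigma> \<and> \<sigma> < 1 / 4 + \<epsilon> \<and>
    real n / 2 \<le> h \<and> ground (set (zip as ps)) \<sigma> h \<and>
    floor_at (set (zip as (run alg as))) \<sigma> (r * h) \<and> r * h \<le> height as (run alg as)"
proof (induction n)
  case 0
  have "ground {} (1 / 4) 0"
    by (simp add: ground_def supported_def)
  then show ?case
    using \<epsilon> by (intro exI[of _ "[]"] exI[of _ "1 / 4"] exI[of _ 0])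
      (auto simp: inputs_def valid_packing_Nil run_def height_def intro: floor_at_0)
next
  case (Suc n)
  then obtain as ps \<sigma> h where as: "as \<in> inputs" and val: "valid_packing as ps"
    and \<sigma>: "1 / 4 \<le> \<sigma>" "\<sigma> < 1 / 4 + \<epsilon>" and h: "real n / 2 \<le> h"
    and g: "ground (set (zip as ps)) \<sigma> h"
    and fl: "floor_at (set (zip as (run alg as))) \<sigma> (r * h)"
    by blast
  \<comment> \<open>The midpoint makes the sides grow strictly forever without reaching
    \<open>1 / 4 + \<epsilon>\<close>.\<close>
  define s where "s = (\<sigma> + (1 / 4 + \<epsilon>)) / 2"
  have s: "\<sigma> < s" "1 / 4 < s" "s < 1 / 4 + \<epsilon>" "s \<le> 1 / 3" "0 < s"
    using \<sigma> \<epsilon> by (auto simp: s_def)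
  have "0 \<le> h"
    using h by (rule order_trans[rotated]) simp
  note pack = packing_piled[OF val g \<open>0 \<le> h\<close> s(5,1,4)]
    packing_side_by_side[OF val g \<open>0 \<le> h\<close> s(5,1,4)]
  obtain B G where BG: "B = 3 / 4 \<and> G = 5 / 4 \<or> B = 1 - s \<and> G = 1"
    and fl': "floor_at (set (zip (as @ [s, s, B]) (run alg (as @ [s, s, B])))) s (r * h + G)"
    and ht': "r * h + G \<le> height (as @ [s, s, B]) (run alg (as @ [s, s, B]))"
    using algorithm_round[OF alg as fl s(1,2,4)] by blast
  \<comment> \<open>The offline rise \<open>d\<close> is at least \<open>1 / 2\<close>, so
    \<open>h\<close> grows without bound, while \<open>r * d \<le> G\<close> preserves the
    factor.\<close>
  have "\<exists>ps' d. valid_packing (as @ [s, s, B]) ps' \<and>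
    ground (set (zip (as @ [s, s, B]) ps')) s (h + d) \<and> 1 / 2 \<le> d \<and> r * d \<le> G"
    using BG
  proof (elim disjE conjE)
    assume B: "B = 3 / 4" and G: "G = 5 / 4"
    have "r * (s + 3 / 4) \<le> r * (1 + \<epsilon>)"
      using s r by (intro mult_left_mono) auto
    then have "r * (s + 3 / 4) \<le> G"
      using r G by linarith
    moreover have "1 / 2 \<le> s + 3 / 4"
      using s by simp
    ultimately show ?thesis
      using pack(3) pack(4)[unfolded add.assoc] unfolding B by blast
  next
    assume B: "B = 1 - s" and G: "G = 1"
    \<comment> \<open>From \<open>s > 1 / 4\<close> follows \<open>4 / 3 * (1 - s) \<le> 1\<close>;
      then \<open>r * (1 - s)\<close> is at most \<open>3 / 4 * (5 / 4) = 15 / 16\<close>.\<close>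
    have "r * (4 / 3 * (1 - s)) \<le> r * (1 + \<epsilon>)"
      using s r \<epsilon> by (intro mult_left_mono) auto
    then have "r * (1 - s) \<le> 15 / 16"
      using r by (simp add: algebra_simps)
    then have "r * (1 - s) \<le> G"
      using G by simp
    moreover have "1 / 2 \<le> 1 - s"
      using s by simp
    ultimately show ?thesis
      using pack(1,2) unfolding B by blast
  qed
  then obtain ps' d where d: "valid_packing (as @ [s, s, B]) ps'"
    "ground (set (zip (as @ [s, s, B]) ps')) s (h + d)" "1 / 2 \<le> d" "r * d \<le> G"
    by blast
  have le: "r * (h + d) \<le> r * h + G"
    using d(4) by (simp add: distrib_left)
  have "as @ [s, s, B] \<in> inputs"
    using as s BG by (auto simp: inputs_def)
  moreover have "real (Suc n) / 2 \<le> h + d"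
    using h d(3) by (simp add: add_divide_distrib)
  ultimately show ?case
    using d(1,2) s floor_at_weaken[OF fl' le] order_trans[OF le ht']
    by (intro exI[of _ "as @ [s, s, B]"] exI[of _ ps'] exI[of _ s] exI[of _ "h + d"]) auto
qed

theorem theorem3:
  shows "\<not> (\<exists>alg c. online_algorithm alg \<and> c < 5 / 4 \<and> has_asymptotic_competitive_ratio alg c)"
proof
  assume "\<exists>alg c. online_algorithm alg \<and> c < 5 / 4 \<and> has_asymptotic_competitive_ratio alg c"
  then obtain alg c b where alg: "online_algorithm alg" and c: "c < 5 / 4"
    and ratio: "\<And>as. as \<in> inputs \<Longrightarrow> height as (run alg as) \<le> c * OPT as + b"
    unfolding has_asymptotic_competitive_ratio_def by blast
  \<comment> \<open>The ratio \<open>c\<close> may be small or negative. Raising it to at least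
    \<open>6 / 5\<close> makes multiplication by \<open>c'\<close> monotone and gives
    \<open>r \<ge> 49 / 40\<close>, which forces \<open>\<epsilon> \<le> 1 / 12\<close>;
    \<open>\<epsilon>\<close> itself solves \<open>r * (1 + \<epsilon>) = 5 / 4\<close>.\<close>
  define c' where "c' = max c (6 / 5)"
  define r where "r = (c' + 5 / 4) / 2"
  define \<epsilon> where "\<epsilon> = 5 / (4 * r) - 1"
  have r: "c' < r" "r < 5 / 4" "49 / 40 \<le> r"
    using c by (auto simp: c'_def r_def)
  have \<epsilon>: "0 < \<epsilon>" "\<epsilon> \<le> 1 / 12" "r * (1 + \<epsilon>) \<le> 5 / 4"
    using r by (auto simp: \<epsilon>_def field_simps)
  \<comment> \<open>Enough rounds for \<open>h \<ge> n / 2\<close> to exceed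
    \<open>b / (r - c')\<close>, the bound that the assumed ratio imposes on
    \<open>h\<close>.\<close>
  obtain n :: nat where n: "2 * (b / (r - c')) < real n"
    using reals_Archimedean2 by blast
  obtain as ps \<sigma> h where as: "as \<in> inputs" and val: "valid_packing as ps"
    and h: "real n / 2 \<le> h" and g: "ground (set (zip as ps)) \<sigma> h"
    and alg_ge: "r * h \<le> height as (run alg as)"
    using adversary[OF alg \<epsilon>(1,2) _ \<epsilon>(3), of n] r by auto
  have "0 \<le> h"
    using h by (rule order_trans[rotated]) simp
  then have "OPT as \<le> h"
    using OPT_le_height[OF val] height_le[of h as ps] groundD(2)[OF g] by (meson order_trans)
  have "r * h \<le> c * OPT as + b"
    using alg_ge ratio[OF as] by linarith
  also have "c * OPT as \<le> c' * OPT as"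
    using OPT_nonneg[OF val] by (intro mult_right_mono) (auto simp: c'_def)
  also have "c' * OPT as \<le> c' * h"
    using \<open>OPT as \<le> h\<close> by (intro mult_left_mono) (auto simp: c'_def)
  finally have "(r - c') * h \<le> b"
    by (simp add: left_diff_distrib)
  then have "h \<le> b / (r - c')"
    using r by (simp add: pos_le_divide_eq mult.commute)
  then show False
    using n h by linarith
qed

end
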